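(* Let $\phi(z)=Az+p(z)$, $A\ge1$, be a self-map of $\mathbb{H}$ of non-zero-step type, and let $(g,\alpha)$ be the classical semiconjugation of $\phi$ based at some point $z_0\in\mathbb{H}$. Given $(\sigma,\tau)\in\mathcal{F}(\phi)$, there is an analytic map $F:\mathbb{H}\to\mathbb{H}$ such that $$\sigma=F\circ g\qquad\text{and}\qquad F\circ\alpha=\tau\circ F .$$ Moreover, $\sigma$ is canonical (with respect to $\phi$ and $\tau$) if and only if $F$ is canonical (with respect to $\alpha$ and $\tau$).
   Context: $\mathbb{H}=\{z\in\mathbb{C}:\operatorname{Im}z>0\}$; $\rho_{\mathbb{H}}$ is the hyperbolic distance; $\phi_n$ is the $n$-th iterate of $\phi$; n.t.-lim as $z\to\infty$ means the limit as $z\to\infty$ inside each sector $\{|\operatorname{Arg}z-\pi/2|<\theta\}$, $0<\theta<\pi/2$. Here a self-map of $\mathbb{H}$ is an analytic map $\phi:\mathbb{H}\to\mathbb{H}$ that is not an automorphism. We consider $\phi(z)=Az+p(z)$ with $A\ge 1$, $\operatorname{Im}p>0$ on $\mathbb{H}$ and n.t.-$\lim_{z\to\infty}p(z)/z=0$. It is hyperbolic if $A>1$ and parabolic if $A=1$. For $z\in\mathbb{H}$ the sequence $\rho_{\mathbb{H}}(\phi_n(z),\phi_{n+1}(z))$ decreases to a limit $s_\infty(z)\ge0$; for parabolic $\phi$, $s_\infty$ vanishes either everywhere (zero-step) or nowhere (non-zero-step). $\phi$ is of non-zero-step type if it is hyperbolic or parabolic non-zero-step. Classical semiconjugation based at $z_0$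 (for $\phi$ of non-zero-step type): let $z_n=\phi_n(z_0)=x_n+iy_n$ and $\gamma_n(z)=(z-x_n)/y_n$. By a theorem of Pommerenke, $g=\lim_n\gamma_n\circ\phi_n$ exists locally uniformly in $\mathbb{H}$, is an analytic map $\mathbb{H}\to\mathbb{H}$ with $g(z_0)=i$, the maps $\gamma_n\circ\gamma_{n+1}^{-1}$ converge to $\alpha(z)=Az+b$ with $b=\lim_n(x_{n+1}-x_n)/y_n\in\mathbb{R}$, and $g\circ\phi=\alpha\circ g$; if $A=1$ then $b\neq0$. $\mathcal{F}(\phi)$ is the set of pairs $(\sigma,\tau)$ with $\sigma:\mathbb{H}\to\mathbb{H}$ analytic and non-constant, $\tau\in\operatorname{Aut}(\mathbb{H})$, and $\sigma\circ\phi=\tau\circ\sigma$. Two points $z,w$ are in the same grand orbit of a map $\psi$ if $\psi_n(z)=\psi_k(w)$ for some integers $n,k\ge0$; grand orbits are the equivalence classes and $\mathcal{G}(\psi)$ is the set of grand orbits. If $f\circ\psi=\tau\circ f$, then $f$ induces a map $\mathcal{G}(\psi)\to\mathcal{G}(\tau)$; $f$ is called canonical (with respect to $\psi$ and $\tau$) if this induced map is a bijection. *)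

theory Defs
  imports "HOL-Complex_Analysis.Complex_Analysis"
begin

text \<open>
  Maps of the upper half-plane are total functions of type \<^typ>\<open>complex \<Rightarrow> complex\<close> whose
  values outside the half-plane are irrelevant.
\<close>

definition uhp :: "complex set" where
  "uhp = {z. Im z > 0}"

definition analytic_into_uhp :: "(complex \<Rightarrow> complex) \<Rightarrow> bool" where
  "analytic_into_uhp f \<longleftrightarrow> f holomorphic_on uhp \<and> f ` uhp \<subseteq> uhp"

definition automorphism_uhp :: "(complex \<Rightarrow> complex) \<Rightarrow> bool" where
  "automorphism_uhp f \<longleftrightarrow>
     f holomorphic_on uhp \<and> bij_betw f uhp uhp \<and> inv_into uhp f holomorphic_on uhp"

definition self_map_uhp :: "(complex \<Rightarrow> complex) \<Rightarrow> bool" where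
  "self_map_uhp f \<longleftrightarrow> analytic_into_uhp f \<and> \<not> automorphism_uhp f"

text \<open>
  Limit at infinity inside every sector \<open>\<bar>Arg z - \<pi>/2\<bar> < \<theta>\<close> with \<open>0 < \<theta> < \<pi>/2\<close>; all these
  sectors lie in the upper half-plane (note that \<open>Arg 0 = 0\<close>, so they do not contain 0).
\<close>

definition nt_lim_infinity :: "(complex \<Rightarrow> complex) \<Rightarrow> complex \<Rightarrow> bool" where
  "nt_lim_infinity f l \<longleftrightarrow>
     (\<forall>\<theta>. 0 < \<theta> \<and> \<theta> < pi / 2 \<longrightarrow>
        (f \<longlongrightarrow> l) (inf at_infinity (principal {z. \<bar>Arg z - pi / 2\<bar> < \<theta>})))"

text \<open>Hyperbolic distance, normalised to curvature \<open>-1\<close>.\<close>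

definition hyp_dist :: "complex \<Rightarrow> complex \<Rightarrow> real" where
  "hyp_dist z w = arcosh (1 + (cmod (z - w))\<^sup>2 / (2 * Im z * Im w))"

text \<open>
  By the Schwarz-Pick lemma the sequence below is decreasing and nonnegative when \<open>\<phi>\<close> is an
  analytic map of the upper half-plane into itself, so that \<^const>\<open>lim\<close> is a genuine limit.
\<close>

definition step_limit :: "(complex \<Rightarrow> complex) \<Rightarrow> complex \<Rightarrow> real" where
  "step_limit \<phi> z = lim (\<lambda>n. hyp_dist ((\<phi> ^^ n) z) ((\<phi> ^^ Suc n) z))"

definition nonzero_step_type :: "real \<Rightarrow> (complex \<Rightarrow> complex) \<Rightarrow> bool" where
  "nonzero_step_type A \<phi> \<longleftrightarrow> A > 1 \<or> (A = 1 \<and> (\<forall>z\<in>uhp. step_limit \<phi> z \<noteq> 0))"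

definition renorm :: "(complex \<Rightarrow> complex) \<Rightarrow> complex \<Rightarrow> nat \<Rightarrow> complex \<Rightarrow> complex" where
  "renorm \<phi> z0 n z =
     (z - of_real (Re ((\<phi> ^^ n) z0))) / of_real (Im ((\<phi> ^^ n) z0))"

text \<open>
  The pair \<open>(g, \<alpha>)\<close> is given by its defining limits only. That the limits exist, that
  \<open>g\<close> is an analytic map into the half-plane with \<open>g z0 = \<i>\<close>, that \<open>\<alpha> z = A * z + b\<close>
  with \<open>b = lim (x\<^sub>n\<^sub>+\<^sub>1 - x\<^sub>n) / y\<^sub>n\<close> for \<open>(\<phi> ^^ n) z0 = x\<^sub>n + \<i> y\<^sub>n\<close>, and that
  \<open>g \<circ> \<phi> = \<alpha> \<circ> g\<close> are consequences (Pommerenke), not part of the definition.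
\<close>

definition classical_semiconjugation ::
    "(complex \<Rightarrow> complex) \<Rightarrow> complex \<Rightarrow> (complex \<Rightarrow> complex) \<Rightarrow> (complex \<Rightarrow> complex) \<Rightarrow> bool" where
  "classical_semiconjugation \<phi> z0 g \<alpha> \<longleftrightarrow>
     (\<forall>K. compact K \<and> K \<subseteq> uhp \<longrightarrow>
        uniform_limit K (\<lambda>n. renorm \<phi> z0 n \<circ> (\<phi> ^^ n)) g sequentially) \<and>
     (\<forall>z\<in>uhp. (\<lambda>n. (renorm \<phi> z0 n \<circ> inv (renorm \<phi> z0 (Suc n))) z) \<longlonglongrightarrow> \<alpha> z)"

definition semiconjugations ::
    "(complex \<Rightarrow> complex) \<Rightarrow> ((complex \<Rightarrow> complex) \<times> (complex \<Rightarrow> complex)) set" where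
  "semiconjugations \<phi> = {(\<sigma>, \<tau>).
     analytic_into_uhp \<sigma> \<and> \<not> \<sigma> constant_on uhp \<and> automorphism_uhp \<tau> \<and>
     (\<forall>z\<in>uhp. \<sigma> (\<phi> z) = \<tau> (\<sigma> z))}"

definition grand_orbit_rel :: "(complex \<Rightarrow> complex) \<Rightarrow> (complex \<times> complex) set" where
  "grand_orbit_rel \<psi> =
     {(z, w). z \<in> uhp \<and> w \<in> uhp \<and> (\<exists>n k. (\<psi> ^^ n) z = (\<psi> ^^ k) w)}"

definition grand_orbits :: "(complex \<Rightarrow> complex) \<Rightarrow> complex set set" where
  "grand_orbits \<psi> = uhp // grand_orbit_rel \<psi>"

definition induced_map ::
    "(complex \<Rightarrow> complex) \<Rightarrow> (complex \<Rightarrow> complex) \<Rightarrow> complex set \<Rightarrow> complex set" where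
  "induced_map \<tau> f C = grand_orbit_rel \<tau> `` (f ` C)"

definition canonical ::
    "(complex \<Rightarrow> complex) \<Rightarrow> (complex \<Rightarrow> complex) \<Rightarrow> (complex \<Rightarrow> complex) \<Rightarrow> bool" where
  "canonical f \<psi> \<tau> \<longleftrightarrow>
     (\<forall>z\<in>uhp. f (\<psi> z) = \<tau> (f z)) \<and>
     bij_betw (induced_map \<tau> f) (grand_orbits \<psi>) (grand_orbits \<tau>)"

lemma funpow_in_uhp:
  assumes "\<psi> ` uhp \<subseteq> uhp" "z \<in> uhp"
  shows "(\<psi> ^^ n) z \<in> uhp"
  using assms by (induction n) auto

lemma equiv_grand_orbit_rel: "equiv uhp (grand_orbit_rel \<psi>)"
proof (rule equivI)
  show "grand_orbit_rel \<psi> \<subseteq> uhp \<times> uhp"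
    by (auto simp: grand_orbit_rel_def)
  show "refl_on uhp (grand_orbit_rel \<psi>)"
    by (auto simp: grand_orbit_rel_def refl_on_def)
  show "sym (grand_orbit_rel \<psi>)"
    unfolding grand_orbit_rel_def sym_def by (auto intro: sym)
  show "trans (grand_orbit_rel \<psi>)"
  proof (rule transI)
    fix x y z
    assume xy: "(x, y) \<in> grand_orbit_rel \<psi>" and yz: "(y, z) \<in> grand_orbit_rel \<psi>"
    from xy yz obtain n k m l
      where 1: "(\<psi> ^^ n) x = (\<psi> ^^ k) y" and 2: "(\<psi> ^^ m) y = (\<psi> ^^ l) z"
      by (auto simp: grand_orbit_rel_def)
    have "(\<psi> ^^ (m + n)) x = (\<psi> ^^ (m + k)) y"
      using 1 by (simp add: funpow_add)
    also have "\<dots> = (\<psi> ^^ (k + m)) y"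
      by (simp add: add.commute)
    also have "\<dots> = (\<psi> ^^ (k + l)) z"
      using 2 by (simp add: funpow_add)
    finally show "(x, z) \<in> grand_orbit_rel \<psi>"
      using xy yz by (auto simp: grand_orbit_rel_def)
  qed
qed

lemma induced_map_class:
  assumes \<psi>: "\<psi> ` uhp \<subseteq> uhp" and f: "f ` uhp \<subseteq> uhp"
    and semi: "\<And>z. z \<in> uhp \<Longrightarrow> f (\<psi> z) = \<tau> (f z)" and z: "z \<in> uhp"
  shows "induced_map \<tau> f (grand_orbit_rel \<psi> `` {z}) = grand_orbit_rel \<tau> `` {f z}"
proof -
  have it: "f ((\<psi> ^^ n) w) = (\<tau> ^^ n) (f w)" if "w \<in> uhp" for n w
    using that by (induction n) (simp_all add: semi funpow_in_uhp[OF \<psi>])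
  have rel: "(f z, f w) \<in> grand_orbit_rel \<tau>" if zw: "(z, w) \<in> grand_orbit_rel \<psi>" for w
  proof -
    obtain n k where "z \<in> uhp" "w \<in> uhp" "(\<psi> ^^ n) z = (\<psi> ^^ k) w"
      using zw by (auto simp: grand_orbit_rel_def)
    moreover from this have "(\<tau> ^^ n) (f z) = (\<tau> ^^ k) (f w)"
      by (metis it)
    ultimately show ?thesis using f by (auto simp: grand_orbit_rel_def)
  qed
  have eq: "grand_orbit_rel \<tau> `` {f w} = grand_orbit_rel \<tau> `` {f z}"
    if "(z, w) \<in> grand_orbit_rel \<psi>" for w
    using equiv_class_eq[OF equiv_grand_orbit_rel rel[OF that]] by simp
  have "(z, z) \<in> grand_orbit_rel \<psi>"
    using z by (auto simp: grand_orbit_rel_def)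
  with eq show ?thesis
    unfolding induced_map_def by blast
qed

end

(* If \<sigma> o \<phi> = \<tau> o \<sigma>, then \<sigma> = (\<tau>^-n o \<sigma> o \<gamma>_n^-1) o (\<gamma>_n o \<phi>_n), where the second factor tends
   to g and the first ones form a normal family; any of its limit functions can serve as F.
   For (\<sigma>, \<tau>) = (g, \<alpha>) the only limit function is the identity.  Maps close to the identity are
   locally surjective (Hurwitz) and locally injective (Cauchy's estimate); hence
   \<alpha>_n(w) lies in the range of g for some n, and g(z) = g(w) forces \<phi>_n(z) = \<phi>_n(w) for some n.
   So g is canonical, and \<sigma> = F o g is canonical if and only if F is. *)

theory Submission
  imports Defs
begin

section \<open>Analytic self-maps of the upper half-plane\<close>

lemma open_uhp: "open uhp"
  unfolding uhp_def by (rule open_halfspace_Im_gt)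

lemma connected_uhp: "connected uhp"
  unfolding uhp_def by (intro convex_connected convex_halfspace_Im_gt)

lemma analytic_into_uhp_in:
  "analytic_into_uhp f \<Longrightarrow> z \<in> uhp \<Longrightarrow> f z \<in> uhp"
  by (auto simp: analytic_into_uhp_def)

lemma analytic_into_uhp_compose:
  assumes "analytic_into_uhp f" "analytic_into_uhp h"
  shows "analytic_into_uhp (\<lambda>z. f (h z))"
  using assms holomorphic_on_compose_gen[of h uhp f uhp]
  by (simp add: analytic_into_uhp_def image_subset_iff o_def)

lemma analytic_into_uhp_funpow:
  assumes "analytic_into_uhp f"
  shows "analytic_into_uhp (f ^^ n)"
proof (induction n)
  case 0
  then show ?case by (simp add: analytic_into_uhp_def id_def holomorphic_on_ident)
next
  case (Suc n)
  then show ?case using analytic_into_uhp_compose[OF assms Suc] by (simp add: o_def)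
qed

lemma analytic_into_uhp_affine:
  assumes "a > 0"
  shows "analytic_into_uhp (\<lambda>z. of_real a * z + of_real b)"
  using assms by (auto simp: analytic_into_uhp_def uhp_def intro!: holomorphic_intros)

section \<open>The Cayley transform between half-plane and unit disc\<close>

text \<open>Moves families of maps into the half-plane to the unit disc, where they are uniformly
  bounded and Montel's theorem applies.\<close>

definition cayley :: "complex \<Rightarrow> complex" where
  "cayley z = (z - \<i>) / (z + \<i>)"

definition cayley_inv :: "complex \<Rightarrow> complex" where
  "cayley_inv w = \<i> * (1 + w) / (1 - w)"

lemma plus_i_neq_0: "z \<in> uhp \<Longrightarrow> z + \<i> \<noteq> 0"
  by (auto simp: uhp_def complex_eq_iff)

lemma cayley_in_ball:
  assumes "z \<in> uhp"
  shows "cayley z \<in> ball 0 1"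
proof -
  have "(Im z - 1)\<^sup>2 < (Im z + 1)\<^sup>2"
    using assms by (simp add: uhp_def power2_eq_square algebra_simps)
  then have "(cmod (z - \<i>))\<^sup>2 < (cmod (z + \<i>))\<^sup>2"
    by (simp add: cmod_power2)
  then have "cmod (z - \<i>) < cmod (z + \<i>)"
    using power2_less_imp_less by fastforce
  then show ?thesis
    using plus_i_neq_0[OF assms] by (simp add: cayley_def norm_divide)
qed

lemma cayley_inv_cayley:
  assumes "z \<in> uhp"
  shows "cayley_inv (cayley z) = z"
proof -
  have "1 + cayley z = 2 * z / (z + \<i>)" "1 - cayley z = 2 * \<i> / (z + \<i>)"
    using plus_i_neq_0[OF assms] by (simp_all add: cayley_def field_simps)
  then show ?thesis
    using plus_i_neq_0[OF assms] by (simp add: cayley_inv_def)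
qed

lemma cayley_inv_in_uhp:
  assumes "w \<in> ball 0 1"
  shows "cayley_inv w \<in> uhp"
proof -
  have "1 - w \<noteq> 0" using assms by auto
  \<comment> \<open>The imaginary part of \<open>cayley_inv w\<close> is (1 - |w|^2) / |1 - w|^2;
    denominator and numerator are shown to be positive in turn.\<close>
  then have "(Re (1 - w))\<^sup>2 + (Im (1 - w))\<^sup>2 > 0"
    by (simp only: complex_neq_0)
  moreover have "(Re w)\<^sup>2 + (Im w)\<^sup>2 < 1"
    using assms by (simp add: abs_square_less_1 flip: cmod_power2)
  ultimately show ?thesis
    by (simp add: uhp_def cayley_inv_def Im_divide power2_eq_square algebra_simps)
qed

lemma holomorphic_on_cayley: "cayley holomorphic_on uhp"
  unfolding cayley_def using plus_i_neq_0 by (auto intro!: holomorphic_intros)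

lemma holomorphic_on_cayley_inv: "cayley_inv holomorphic_on ball 0 1"
  unfolding cayley_inv_def by (auto intro!: holomorphic_intros)

section \<open>Limits of holomorphic maps\<close>

text \<open>A nonconstant image is open, and a constant one is decided by the point
  \<open>z0\<close>. The use is for limit functions: a priori they take values only in a closure,
  and one interior value keeps them off the boundary everywhere.\<close>

lemma holomorphic_image_subset_interior:
  assumes "f holomorphic_on S" "open S" "connected S" "f ` S \<subseteq> T"
    and z0: "z0 \<in> S" "f z0 \<in> interior T"
  shows "f ` S \<subseteq> interior T"
proof (cases "f constant_on S")
  case True
  then show ?thesis using z0 by (auto simp: constant_on_def)
next
  case False
  have "open (f ` S)"
    using open_mapping_thm[OF assms(1-3) assms(2) order_refl False] .
  then show ?thesis using assms(4) by (simp add: interior_maximal)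
qed

text \<open>Uniformity controls \<open>f n\<close> against \<open>F\<close> at the moving point
  \<open>u n\<close>, and continuity controls \<open>F (u n)\<close> against \<open>F x\<close>. It
  serves to evaluate limit functions along the points \<gamma>_n(\<phi>_n(z)), which move with
  n.\<close>

lemma tendsto_uniform_limit_diagonal:
  fixes F :: "'a::metric_space \<Rightarrow> 'b::metric_space"
  assumes ul: "uniform_limit K f F sequentially"
    and u: "u \<longlonglongrightarrow> x" "\<forall>\<^sub>F n in sequentially. u n \<in> K" and F: "isCont F x"
  shows "(\<lambda>n. f n (u n)) \<longlonglongrightarrow> F x"
proof (rule tendstoI)
  fix e :: real assume "e > 0"
  then have e: "e / 2 > 0" by simp
  have 1: "\<forall>\<^sub>F n in sequentially. dist (F (u n)) (F x) < e / 2"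
    using tendstoD[OF isCont_tendsto_compose[OF F u(1)] e] .
  have 2: "\<forall>\<^sub>F n in sequentially. \<forall>y\<in>K. dist (f n y) (F y) < e / 2"
    using uniform_limitD[OF ul e] .
  from 1 2 u(2) show "\<forall>\<^sub>F n in sequentially. dist (f n (u n)) (F x) < e"
  proof eventually_elim
    case (elim n)
    then have "dist (f n (u n)) (F (u n)) < e / 2" by blast
    then show ?case
      using elim(1) dist_triangle[of "f n (u n)" "F x" "F (u n)"] by linarith
  qed
qed

text \<open>Cauchy's estimate makes \<open>f n - id\<close> a contraction on a fixed disc for large \<open>n\<close>.\<close>

lemma eventually_inj_of_uniform_limit_ident:
  fixes \<zeta> :: complex
  assumes r: "r > 0" and hol: "\<And>n. f n holomorphic_on S" and S: "open S" "cball \<zeta> r \<subseteq> S"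
    and ul: "uniform_limit (cball \<zeta> r) f (\<lambda>z. z) sequentially"
  shows "\<forall>\<^sub>F n in sequentially. inj_on (f n) (ball \<zeta> (r / 2))"
proof -
  have "r / 4 > 0" using r by simp
  from uniform_limitD[OF ul this] show ?thesis
  proof eventually_elim
    case (elim n)
    define e where "e = (\<lambda>z. f n z - z)"
    have hole: "e holomorphic_on S"
      unfolding e_def by (intro holomorphic_intros hol)
    have bound: "cmod (deriv e z) \<le> 1 / 2" if z: "z \<in> ball \<zeta> (r / 2)" for z
    proof -
      have sub: "cball z (r / 2) \<subseteq> cball \<zeta> r"
      proof
        fix y assume "y \<in> cball z (r / 2)"
        then show "y \<in> cball \<zeta> r"
          using z dist_triangle[of \<zeta> y z] by auto
      qed
      \<comment> \<open>The disc of radius \<open>r / 2\<close> about \<open>z\<close> stays in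
        \<open>cball \<zeta> r\<close>, where |e| < r / 4; the quotient of these two numbers is the
        contraction constant 1 / 2.\<close>
      have "cmod ((deriv ^^ 1) e z) \<le> fact 1 * (r / 4) / (r / 2) ^ 1"
      proof (rule Cauchy_higher_deriv_bound)
        show "e holomorphic_on ball z (r / 2)"
          using hole sub S ball_subset_cball by (meson holomorphic_on_subset order_trans)
        show "continuous_on (cball z (r / 2)) e"
          using hole sub S by (meson holomorphic_on_imp_continuous_on continuous_on_subset order_trans)
        show "e w \<in> ball 0 (r / 4)" if "w \<in> ball z (r / 2)" for w
        proof -
          have "w \<in> cball \<zeta> r" using that sub ball_subset_cball by blast
          then show ?thesis using elim by (simp add: e_def dist_norm norm_minus_commute)
        qed
      qed (use r in auto)
      then show ?thesis using r by simp
    qed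
    show ?case
    proof (rule inj_onI)
      fix u v assume uv: "u \<in> ball \<zeta> (r / 2)" "v \<in> ball \<zeta> (r / 2)" "f n u = f n v"
      have "cmod (e u - e v) \<le> 1 / 2 * cmod (u - v)"
      proof (rule field_differentiable_bound[of "ball \<zeta> (r / 2)"])
        fix z assume z: "z \<in> ball \<zeta> (r / 2)"
        then have "z \<in> S" using S r by (auto simp: subset_iff)
        then show "(e has_field_derivative deriv e z) (at z within ball \<zeta> (r / 2))"
          using hole S(1) holomorphic_derivI by (metis has_field_derivative_at_within)
      qed (use bound uv in auto)
      \<comment> \<open>Equal values of \<open>f n\<close> give \<open>e u - e v = v - u\<close>, so
        the contraction estimate forces |u - v| \<le> |u - v| / 2.\<close>
      moreover have "cmod (e u - e v) = cmod (u - v)"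
        using uv(3) by (simp add: e_def norm_minus_commute)
      ultimately show "u = v" by simp
    qed
  qed
qed

section \<open>Normal families of maps into the half-plane\<close>

text \<open>Montel's theorem in the disc gives a limit \<open>G\<close> with values in the closed
  disc. The values of \<open>\<Phi> n\<close> at \<open>u n\<close> tend to an interior point, so
  \<open>G \<zeta> = cayley l\<close> lies in the open disc and hence so does the whole image of
  \<open>G\<close>. This prevents the maps from degenerating to the boundary or to infinity.\<close>

lemma Montel_uhp:
  assumes \<Phi>: "\<And>n. analytic_into_uhp (\<Phi> n)"
    and u: "u \<longlonglongrightarrow> \<zeta>" "\<zeta> \<in> uhp" and l: "(\<lambda>n. \<Phi> n (u n)) \<longlonglongrightarrow> l" "l \<in> uhp"
  obtains F r where "analytic_into_uhp F" "strict_mono (r :: nat \<Rightarrow> nat)"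
    "\<And>K. compact K \<Longrightarrow> K \<subseteq> uhp \<Longrightarrow> uniform_limit K (\<lambda>n. \<Phi> (r n)) F sequentially"
proof -
  define \<Psi> where "\<Psi> = (\<lambda>n z. cayley (\<Phi> n z))"
  have \<Psi>ball: "\<Psi> n z \<in> ball 0 1" if "z \<in> uhp" for n z
    using cayley_in_ball analytic_into_uhp_in[OF \<Phi> that] by (simp add: \<Psi>_def)
  have hol\<Psi>: "\<Psi> n holomorphic_on uhp" for n
    using holomorphic_on_compose_gen[OF _ holomorphic_on_cayley, of "\<Phi> n" uhp] \<Phi>[of n]
    unfolding \<Psi>_def analytic_into_uhp_def o_def by blast
  obtain G r where G: "G holomorphic_on uhp" "strict_mono (r :: nat \<Rightarrow> nat)"
      and lim: "\<And>x. x \<in> uhp \<Longrightarrow> (\<lambda>n. \<Psi> (r n) x) \<longlonglongrightarrow> G x"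
      and ul: "\<And>K. compact K \<Longrightarrow> K \<subseteq> uhp \<Longrightarrow> uniform_limit K (\<Psi> \<circ> r) G sequentially"
  proof (rule Montel[OF open_uhp, of "range \<Psi>" \<Psi>])
    show "\<exists>B. \<forall>h\<in>range \<Psi>. \<forall>z\<in>K. cmod (h z) \<le> B" if "compact K" "K \<subseteq> uhp" for K
    proof (intro exI[of _ 1] ballI)
      fix h z assume "h \<in> range \<Psi>" "z \<in> K"
      then obtain n where "h = \<Psi> n" "z \<in> uhp" using \<open>K \<subseteq> uhp\<close> by blast
      then show "cmod (h z) \<le> 1" using \<Psi>ball[of z n] by simp
    qed
  qed (use hol\<Psi> in auto)
  have Gcball: "G ` uhp \<subseteq> cball 0 1"
  proof clarify
    fix x assume x: "x \<in> uhp"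
    have "\<forall>\<^sub>F n in sequentially. \<Psi> (r n) x \<in> cball 0 1"
      using \<Psi>ball[OF x] ball_subset_cball by (intro always_eventually) blast
    then show "G x \<in> cball 0 1"
      by (rule Lim_in_closed_set[OF closed_cball _ sequentially_bot lim[OF x]])
  qed
  have G\<zeta>: "G \<zeta> = cayley l"
  proof -
    obtain d where d: "d > 0" "cball \<zeta> d \<subseteq> uhp"
      using open_uhp u(2) open_contains_cball by blast
    have ur: "(\<lambda>n. u (r n)) \<longlonglongrightarrow> \<zeta>"
      using LIMSEQ_subseq_LIMSEQ[OF u(1) G(2)] by (simp add: o_def)
    have "(\<lambda>n. (\<Psi> \<circ> r) n (u (r n))) \<longlonglongrightarrow> G \<zeta>"
    proof (rule tendsto_uniform_limit_diagonal[OF ul ur])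
      show "\<forall>\<^sub>F n in sequentially. u (r n) \<in> cball \<zeta> d"
        using tendstoD[OF ur d(1)] by eventually_elim (simp add: dist_commute)
      show "isCont G \<zeta>"
        using G(1) open_uhp u(2)
        by (meson continuous_on_eq_continuous_at holomorphic_on_imp_continuous_on)
    qed (use d in auto)
    moreover have "(\<lambda>n. cayley (\<Phi> (r n) (u (r n)))) \<longlonglongrightarrow> cayley l"
      unfolding cayley_def using plus_i_neq_0[OF l(2)] LIMSEQ_subseq_LIMSEQ[OF l(1) G(2)]
      by (intro tendsto_intros) (auto simp: o_def)
    ultimately show ?thesis
      by (auto simp: \<Psi>_def intro: LIMSEQ_unique)
  qed
  have Gball: "G ` uhp \<subseteq> ball 0 1"
    using holomorphic_image_subset_interior[OF G(1) open_uhp connected_uhp Gcball u(2)]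
      G\<zeta> cayley_in_ball[OF l(2)] by simp
  define F where "F = (\<lambda>z. cayley_inv (G z))"
  have "analytic_into_uhp F"
    using Gball cayley_inv_in_uhp
      holomorphic_on_compose_gen[OF G(1) holomorphic_on_cayley_inv]
    by (auto simp: analytic_into_uhp_def F_def o_def)
  moreover have "uniform_limit K (\<lambda>n. \<Phi> (r n)) F sequentially" if K: "compact K" "K \<subseteq> uhp" for K
  proof -
    have "compact (G ` K)"
      using K G(1) by (meson compact_continuous_image continuous_on_subset holomorphic_on_imp_continuous_on)
    moreover have "G ` K \<subseteq> ball 0 1" using Gball K by blast
    ultimately obtain d where d: "d > 0" "(\<Union>x\<in>G ` K. cball x d) \<subseteq> ball 0 1"
      using compact_subset_open_imp_cball_epsilon_subset[of "G ` K" "ball 0 1"] by blast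
    \<comment> \<open>\<open>cayley_inv\<close> is not uniformly continuous on the whole disc. It is
      on \<open>B\<close>, the closed \<open>d\<close>-neighbourhood of the image of
      \<open>K\<close> under \<open>G\<close>, which is compact, stays in the open disc and
      eventually contains all values of the approximating maps on \<open>K\<close>.\<close>
    define B where "B = {x + y |x y. x \<in> G ` K \<and> y \<in> cball 0 d}"
    have B: "compact B"
      unfolding B_def using \<open>compact (G ` K)\<close> by (intro compact_sums) auto
    have B_iff: "w \<in> B" if "x \<in> K" "dist w (G x) \<le> d" for w x
    proof -
      have "w = G x + (w - G x)" "w - G x \<in> cball 0 d"
        using that by (simp_all add: dist_norm norm_minus_commute)
      then show ?thesis unfolding B_def using that(1) by blast
    qed
    have Bball: "B \<subseteq> ball 0 1"
    proof
      fix w assume "w \<in> B"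
      then obtain x y where "x \<in> G ` K" "cmod y \<le> d" "w = x + y" by (auto simp: B_def)
      then have "w \<in> cball x d" by (simp add: dist_norm)
      then have "w \<in> (\<Union>x\<in>G ` K. cball x d)" using \<open>x \<in> G ` K\<close> by blast
      then show "w \<in> ball 0 1" using d(2) by blast
    qed
    have "uniform_limit K (\<lambda>n z. cayley_inv ((\<Psi> \<circ> r) n z)) (\<lambda>z. cayley_inv (G z)) sequentially"
    proof (rule uniform_limit_compose_uniformly_continuous_on[OF ul[OF K]])
      show "uniformly_continuous_on B cayley_inv"
        using B Bball holomorphic_on_cayley_inv
        by (meson compact_uniformly_continuous continuous_on_subset holomorphic_on_imp_continuous_on)
      show "closed B" using B by (rule compact_imp_closed)
      show "\<forall>\<^sub>F n in sequentially. \<forall>y\<in>K. (\<Psi> \<circ> r) n y \<in> B"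
        using uniform_limitD[OF ul[OF K] d(1)] by eventually_elim (use B_iff in force)
    qed
    then show ?thesis
      unfolding F_def
      by (rule uniform_limit_cong'[THEN iffD1, rotated 2])
         (use K cayley_inv_cayley analytic_into_uhp_in[OF \<Phi>] in \<open>auto simp: \<Psi>_def\<close>)
  qed
  ultimately show ?thesis using that G(2) by blast
qed

section \<open>Automorphisms of the half-plane\<close>

lemma automorphism_uhp_inv:
  assumes "automorphism_uhp \<tau>"
  shows "analytic_into_uhp (inv_into uhp \<tau>)"
  using assms bij_betw_imp_surj_on[OF bij_betw_inv_into, of \<tau> uhp uhp]
  by (simp add: automorphism_uhp_def analytic_into_uhp_def)

lemma automorphism_uhp_analytic:
  "automorphism_uhp \<tau> \<Longrightarrow> analytic_into_uhp \<tau>"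
  by (auto simp: automorphism_uhp_def analytic_into_uhp_def bij_betw_def)

lemma funpow_inv_into:
  assumes "automorphism_uhp \<tau>" "z \<in> uhp"
  shows "(inv_into uhp \<tau> ^^ n) ((\<tau> ^^ n) z) = z"
    and "(\<tau> ^^ n) ((inv_into uhp \<tau> ^^ n) z) = z"
proof -
  have b: "bij_betw \<tau> uhp uhp" using assms by (simp add: automorphism_uhp_def)
  have *: "(\<tau> ^^ n) z \<in> uhp" "(inv_into uhp \<tau> ^^ n) z \<in> uhp" for n
    using analytic_into_uhp_in[OF analytic_into_uhp_funpow] assms
      automorphism_uhp_inv automorphism_uhp_analytic by auto
  show "(inv_into uhp \<tau> ^^ n) ((\<tau> ^^ n) z) = z"
  proof (induction n)
    case (Suc n)
    \<comment> \<open>The extra inverse is moved to the innermost place, where it meets the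
      outermost \<open>\<tau>\<close> and cancels.\<close>
    have "(inv_into uhp \<tau> ^^ Suc n) ((\<tau> ^^ Suc n) z) =
        (inv_into uhp \<tau> ^^ n) (inv_into uhp \<tau> (\<tau> ((\<tau> ^^ n) z)))"
      by (simp add: funpow_swap1)
    then show ?case using Suc bij_betw_inv_into_left[OF b *(1)] by simp
  qed simp
  show "(\<tau> ^^ n) ((inv_into uhp \<tau> ^^ n) z) = z"
  proof (induction n)
    case (Suc n)
    have "(\<tau> ^^ Suc n) ((inv_into uhp \<tau> ^^ Suc n) z) =
        (\<tau> ^^ n) (\<tau> (inv_into uhp \<tau> ((inv_into uhp \<tau> ^^ n) z)))"
      by (simp add: funpow_swap1)
    then show ?case using Suc bij_betw_inv_into_right[OF b *(2)] by simp
  qed simp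
qed

text \<open>The explicit affine inverse \<open>h\<close> agrees with \<open>inv_into uhp f\<close>
  on the half-plane, which makes the latter holomorphic. The formula for \<open>f\<close> is assumed
  only there because \<alpha> is determined only there.\<close>

lemma automorphism_uhp_affine:
  assumes a: "a > 0" and f: "\<And>z. z \<in> uhp \<Longrightarrow> f z = of_real a * z + of_real b"
  shows "automorphism_uhp f"
proof -
  define h where "h = (\<lambda>w. of_real (1 / a) * w + of_real (- b / a) :: complex)"
  have h: "analytic_into_uhp h"
    unfolding h_def using a by (intro analytic_into_uhp_affine) simp
  have fi: "analytic_into_uhp (\<lambda>z. of_real a * z + of_real b)"
    by (rule analytic_into_uhp_affine[OF a])
  have fuhp: "f z \<in> uhp" if "z \<in> uhp" for z
    using analytic_into_uhp_in[OF fi that] f that by simp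
  have hf: "h (f z) = z" if "z \<in> uhp" for z
    using a f[OF that] by (simp add: h_def field_simps)
  have fh: "f (h w) = w" if "w \<in> uhp" for w
    using a f[OF analytic_into_uhp_in[OF h that]] by (simp add: h_def field_simps)
  have bij: "bij_betw f uhp uhp"
    using hf fh fuhp analytic_into_uhp_in[OF h] by (intro bij_betw_byWitness[where f' = h]) auto
  have "inv_into uhp f w = h w" if "w \<in> uhp" for w
    using bij fh that analytic_into_uhp_in[OF h that]
    by (intro inv_into_f_eq) (auto simp: bij_betw_def)
  then have "inv_into uhp f holomorphic_on uhp"
    using h holomorphic_cong[of uhp uhp "inv_into uhp f" h] by (simp add: analytic_into_uhp_def)
  moreover have "f holomorphic_on uhp"
    using fi f holomorphic_cong[of uhp uhp f] by (simp add: analytic_into_uhp_def)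
  ultimately show ?thesis using bij by (simp add: automorphism_uhp_def)
qed

section \<open>Grand orbits and canonical maps\<close>

text \<open>The induced map sends the class of \<open>z\<close> to the class of \<open>f z\<close>,
  so its bijectivity comes down to two conditions on points, \<open>inj\<close> and
  \<open>surj\<close>.\<close>

lemma canonicalI:
  assumes \<psi>: "\<psi> ` uhp \<subseteq> uhp" and f: "f ` uhp \<subseteq> uhp"
    and semi: "\<And>z. z \<in> uhp \<Longrightarrow> f (\<psi> z) = \<tau> (f z)"
    and inj: "\<And>z w. (f z, f w) \<in> grand_orbit_rel \<tau> \<Longrightarrow> z \<in> uhp \<Longrightarrow> w \<in> uhp \<Longrightarrow>
      (z, w) \<in> grand_orbit_rel \<psi>"
    and surj: "\<And>w. w \<in> uhp \<Longrightarrow> \<exists>z\<in>uhp. (f z, w) \<in> grand_orbit_rel \<tau>"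
  shows "canonical f \<psi> \<tau>"
proof -
  have cls: "induced_map \<tau> f (grand_orbit_rel \<psi> `` {z}) = grand_orbit_rel \<tau> `` {f z}"
    if "z \<in> uhp" for z
    using induced_map_class[OF \<psi> f semi that] .
  have "bij_betw (induced_map \<tau> f) (grand_orbits \<psi>) (grand_orbits \<tau>)"
    unfolding bij_betw_def
  proof
    show "inj_on (induced_map \<tau> f) (grand_orbits \<psi>)"
    proof (rule inj_onI)
      fix C D assume "C \<in> grand_orbits \<psi>" "D \<in> grand_orbits \<psi>"
        and eq: "induced_map \<tau> f C = induced_map \<tau> f D"
      then obtain z w where zw: "z \<in> uhp" "w \<in> uhp"
        "C = grand_orbit_rel \<psi> `` {z}" "D = grand_orbit_rel \<psi> `` {w}"
        unfolding grand_orbits_def quotient_def by blast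
      then have "(f z, f w) \<in> grand_orbit_rel \<tau>"
        using eq cls f by (simp add: eq_equiv_class_iff[OF equiv_grand_orbit_rel] image_subset_iff)
      then show "C = D"
        using inj zw equiv_class_eq[OF equiv_grand_orbit_rel] by simp
    qed
    show "induced_map \<tau> f ` grand_orbits \<psi> = grand_orbits \<tau>"
    proof (intro equalityI subsetI)
      fix D assume "D \<in> induced_map \<tau> f ` grand_orbits \<psi>"
      then obtain z where "z \<in> uhp" "D = induced_map \<tau> f (grand_orbit_rel \<psi> `` {z})"
        unfolding grand_orbits_def quotient_def by blast
      then show "D \<in> grand_orbits \<tau>"
        using cls f by (auto simp: grand_orbits_def intro!: quotientI)
    next
      fix D assume "D \<in> grand_orbits \<tau>"
      then obtain w where w: "w \<in> uhp" "D = grand_orbit_rel \<tau> `` {w}"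
        unfolding grand_orbits_def quotient_def by blast
      then obtain z where z: "z \<in> uhp" "(f z, w) \<in> grand_orbit_rel \<tau>" using surj by blast
      then have "D = induced_map \<tau> f (grand_orbit_rel \<psi> `` {z})"
        using w cls equiv_class_eq[OF equiv_grand_orbit_rel] by simp
      then show "D \<in> induced_map \<tau> f ` grand_orbits \<psi>"
        using z(1) by (auto simp: grand_orbits_def intro!: imageI quotientI)
    qed
  qed
  then show ?thesis using semi by (simp add: canonical_def)
qed

text \<open>Inducing maps on grand orbits is functorial: the map of \<sigma> is that of
  \<open>F\<close> after that of \<open>g\<close>. As the latter is a bijection, the other two are
  bijective together.\<close>

lemma canonical_compose_iff:
  assumes \<psi>: "\<psi> ` uhp \<subseteq> uhp" and \<alpha>: "\<alpha> ` uhp \<subseteq> uhp" and g: "g ` uhp \<subseteq> uhp" and F: "F ` uhp \<subseteq> uhp"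
    and Fsemi: "\<And>z. z \<in> uhp \<Longrightarrow> F (\<alpha> z) = \<tau> (F z)"
    and can: "canonical g \<psi> \<alpha>" and \<sigma>: "\<And>z. z \<in> uhp \<Longrightarrow> \<sigma> z = F (g z)"
  shows "canonical \<sigma> \<psi> \<tau> \<longleftrightarrow> canonical F \<alpha> \<tau>"
proof -
  have gsemi: "g (\<psi> z) = \<alpha> (g z)" if "z \<in> uhp" for z
    using can that by (simp add: canonical_def)
  have \<sigma>semi: "\<sigma> (\<psi> z) = \<tau> (\<sigma> z)" if "z \<in> uhp" for z
    using that \<psi> g gsemi \<sigma> Fsemi by (simp add: image_subset_iff)
  have \<sigma>uhp: "\<sigma> ` uhp \<subseteq> uhp" using \<sigma> F g by (simp add: image_subset_iff)
  have "induced_map \<tau> \<sigma> C = (induced_map \<tau> F \<circ> induced_map \<alpha> g) C" if C: "C \<in> grand_orbits \<psi>" for C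
  proof -
    obtain z where z: "z \<in> uhp" "C = grand_orbit_rel \<psi> `` {z}"
      using C unfolding grand_orbits_def quotient_def by blast
    then have gz: "g z \<in> uhp" using g by blast
    show ?thesis
      using induced_map_class[OF \<psi> \<sigma>uhp \<sigma>semi z(1)] induced_map_class[OF \<psi> g gsemi z(1)]
        induced_map_class[OF \<alpha> F Fsemi gz] z \<sigma> by simp
  qed
  then have "bij_betw (induced_map \<tau> \<sigma>) (grand_orbits \<psi>) (grand_orbits \<tau>) \<longleftrightarrow>
    bij_betw (induced_map \<tau> F \<circ> induced_map \<alpha> g) (grand_orbits \<psi>) (grand_orbits \<tau>)"
    by (rule bij_betw_cong)
  also have "\<dots> \<longleftrightarrow> bij_betw (induced_map \<tau> F) (grand_orbits \<alpha>) (grand_orbits \<tau>)"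
    using can bij_betw_comp_iff[of "induced_map \<alpha> g"] by (auto simp: canonical_def)
  finally show ?thesis using \<sigma>semi Fsemi by (simp add: canonical_def)
qed

section \<open>The classical semiconjugation\<close>

text \<open>The growth condition \<open>Im_\<phi>\<close> follows from \<open>A \<ge> 1\<close> and
  \<open>Im p > 0\<close>. It makes the heights \<open>Y n\<close> nondecreasing, so that the limit
  map \<alpha> has a dilation factor at least 1 and does not degenerate.\<close>

locale renormalization =
  fixes \<phi> :: "complex \<Rightarrow> complex" and z0 :: complex and g \<alpha> :: "complex \<Rightarrow> complex"
  assumes \<phi>: "analytic_into_uhp \<phi>" and z0: "z0 \<in> uhp"
    and Im_\<phi>: "\<And>z. z \<in> uhp \<Longrightarrow> Im z \<le> Im (\<phi> z)"
    and classical: "classical_semiconjugation \<phi> z0 g \<alpha>"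
begin

abbreviation X :: "nat \<Rightarrow> real" where "X n \<equiv> Re ((\<phi> ^^ n) z0)"
abbreviation Y :: "nat \<Rightarrow> real" where "Y n \<equiv> Im ((\<phi> ^^ n) z0)"

text \<open>This is the inverse of \<gamma>_n, in a form whose analyticity is immediate;
  \<open>inv_renorm\<close> links it to \<open>inv\<close>.\<close>

definition unrenorm :: "nat \<Rightarrow> complex \<Rightarrow> complex" where
  "unrenorm n w = of_real (Y n) * w + of_real (X n)"

lemma iter_in_uhp: "z \<in> uhp \<Longrightarrow> (\<phi> ^^ n) z \<in> uhp"
  using analytic_into_uhp_in[OF analytic_into_uhp_funpow[OF \<phi>]] .

lemma Y_pos: "Y n > 0"
  using iter_in_uhp[OF z0, of n] by (simp add: uhp_def)

lemma renorm_altdef: "renorm \<phi> z0 n = (\<lambda>z. of_real (1 / Y n) * z + of_real (- X n / Y n))"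
  by (rule ext) (simp add: renorm_def diff_divide_distrib)

lemma unrenorm_renorm: "unrenorm n (renorm \<phi> z0 n z) = z"
  using Y_pos[of n] by (simp add: unrenorm_def renorm_def)

lemma renorm_unrenorm: "renorm \<phi> z0 n (unrenorm n z) = z"
  using Y_pos[of n] by (simp add: unrenorm_def renorm_def)

lemma inv_renorm: "inv (renorm \<phi> z0 n) = unrenorm n"
  using unrenorm_renorm renorm_unrenorm by (intro inv_unique_comp ext) auto

lemma analytic_unrenorm: "analytic_into_uhp (unrenorm n)"
  unfolding unrenorm_def by (rule analytic_into_uhp_affine[OF Y_pos])

lemma analytic_renorm_iter: "analytic_into_uhp (\<lambda>z. renorm \<phi> z0 n ((\<phi> ^^ n) z))"
proof (rule analytic_into_uhp_compose[OF _ analytic_into_uhp_funpow[OF \<phi>]])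
  show "analytic_into_uhp (renorm \<phi> z0 n)"
    unfolding renorm_altdef using Y_pos[of n] by (intro analytic_into_uhp_affine) simp
qed

lemma uniform_limit_g:
  assumes "compact K" "K \<subseteq> uhp"
  shows "uniform_limit K (\<lambda>n z. renorm \<phi> z0 n ((\<phi> ^^ n) z)) g sequentially"
  using classical assms by (simp add: classical_semiconjugation_def o_def)

lemma limit_g: "z \<in> uhp \<Longrightarrow> (\<lambda>n. renorm \<phi> z0 n ((\<phi> ^^ n) z)) \<longlonglongrightarrow> g z"
  using tendsto_uniform_limitI[OF uniform_limit_g[of "{z}"], of z] by simp

text \<open>A locally uniform limit is holomorphic but might reach the real line. Since \<gamma>_n
  sends \<phi>_n(z0) to \<open>\<i>\<close> for every n, the value \<open>g z0 = \<i>\<close> is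
  interior, and \<open>holomorphic_image_subset_interior\<close> applies.\<close>

lemma analytic_g: "analytic_into_uhp g"
proof -
  have hol: "g holomorphic_on uhp"
  proof (rule holomorphic_uniform_sequence[OF open_uhp])
    show "(\<lambda>z. renorm \<phi> z0 n ((\<phi> ^^ n) z)) holomorphic_on uhp" for n
      using analytic_renorm_iter by (simp add: analytic_into_uhp_def)
    fix x assume "x \<in> uhp"
    then obtain d where "d > 0" "cball x d \<subseteq> uhp"
      using open_uhp open_contains_cball by blast
    then show "\<exists>d>0. cball x d \<subseteq> uhp \<and>
        uniform_limit (cball x d) (\<lambda>n z. renorm \<phi> z0 n ((\<phi> ^^ n) z)) g sequentially"
      using uniform_limit_g[OF compact_cball] by blast
  qed
  have "(\<lambda>n. \<i>) \<longlonglongrightarrow> g z0"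
  proof -
    have "renorm \<phi> z0 n ((\<phi> ^^ n) z0) = \<i>" for n
      using Y_pos[of n] by (simp add: renorm_def complex_eq_iff)
    then show ?thesis using limit_g[OF z0] by simp
  qed
  then have "g z0 = \<i>" by (simp add: LIMSEQ_const_iff)
  moreover have "g ` uhp \<subseteq> {z. Im z \<ge> 0}"
  proof clarify
    fix z assume z: "z \<in> uhp"
    have "Im (renorm \<phi> z0 n ((\<phi> ^^ n) z)) \<ge> 0" for n
      using analytic_into_uhp_in[OF analytic_renorm_iter z] by (simp add: uhp_def less_imp_le)
    then show "Im (g z) \<ge> 0"
      using tendsto_lowerbound[OF tendsto_Im[OF limit_g[OF z]]] by simp
  qed
  moreover have "interior {z. Im z \<ge> 0} = uhp"
    using interior_halfspace_ge[of \<i> 0] by (simp add: inner_complex_def uhp_def)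
  ultimately have "g ` uhp \<subseteq> uhp"
    using holomorphic_image_subset_interior[OF hol open_uhp connected_uhp, of "{z. Im z \<ge> 0}" z0] z0
    by (simp only:) (simp add: uhp_def)
  with hol show ?thesis by (simp add: analytic_into_uhp_def)
qed

text \<open>Each \<gamma>_n o \<gamma>_(n+1)^-1 is affine with the displayed quotients as
  coefficients. Its value at \<open>\<i>\<close> has the slope as imaginary part and the translation
  as real part, so convergence at this one point gives both limits.\<close>

lemma \<alpha>_affine:
  obtains a b where "a \<ge> 1" "\<And>z. z \<in> uhp \<Longrightarrow> \<alpha> z = of_real a * z + of_real b"
    "(\<lambda>n. Y (Suc n) / Y n) \<longlonglongrightarrow> a" "(\<lambda>n. (X (Suc n) - X n) / Y n) \<longlonglongrightarrow> b"
proof -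
  have lim: "(\<lambda>n. of_real (Y (Suc n) / Y n) * z + of_real ((X (Suc n) - X n) / Y n)) \<longlonglongrightarrow> \<alpha> z"
    if "z \<in> uhp" for z
  proof -
    have "renorm \<phi> z0 n (inv (renorm \<phi> z0 (Suc n)) z) =
        of_real (Y (Suc n) / Y n) * z + of_real ((X (Suc n) - X n) / Y n)" for n
      unfolding inv_renorm using Y_pos[of n]
      by (simp add: renorm_def unrenorm_def field_simps)
    moreover have "(\<lambda>n. renorm \<phi> z0 n (inv (renorm \<phi> z0 (Suc n)) z)) \<longlonglongrightarrow> \<alpha> z"
      using classical that by (simp add: classical_semiconjugation_def o_def)
    ultimately show ?thesis by (simp only:)
  qed
  have i: "\<i> \<in> uhp" by (simp add: uhp_def)
  have a: "(\<lambda>n. Y (Suc n) / Y n) \<longlonglongrightarrow> Im (\<alpha> \<i>)"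
    using tendsto_Im[OF lim[OF i]]
    by (simp only: plus_complex.simps Im_complex_of_real times_complex.simps Re_complex_of_real imaginary_unit.simps) simp
  have b: "(\<lambda>n. (X (Suc n) - X n) / Y n) \<longlonglongrightarrow> Re (\<alpha> \<i>)"
    using tendsto_Re[OF lim[OF i]]
    by (simp only: plus_complex.simps Im_complex_of_real times_complex.simps Re_complex_of_real imaginary_unit.simps) simp
  have "Im (\<alpha> \<i>) \<ge> 1"
  proof (rule tendsto_lowerbound[OF a])
    show "\<forall>\<^sub>F n in sequentially. 1 \<le> Y (Suc n) / Y n"
      using Y_pos Im_\<phi>[OF iter_in_uhp[OF z0]] by (intro always_eventually) simp
  qed simp
  moreover have "\<alpha> z = of_real (Im (\<alpha> \<i>)) * z + of_real (Re (\<alpha> \<i>))" if "z \<in> uhp" for z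
    by (rule LIMSEQ_unique[OF lim[OF that]]) (intro tendsto_intros a b)
  ultimately show ?thesis using that a b by blast
qed

lemma automorphism_\<alpha>: "automorphism_uhp \<alpha>"
  using \<alpha>_affine automorphism_uhp_affine by (metis less_le_trans zero_less_one)

text \<open>Pass to the limit in \<gamma>_n o \<phi>_n o \<phi> = (\<gamma>_n o \<gamma>_(n+1)^-1) o
  (\<gamma>_(n+1) o \<phi>_(n+1)).\<close>

lemma g_semiconj:
  assumes z: "z \<in> uhp"
  shows "g (\<phi> z) = \<alpha> (g z)"
proof -
  obtain a b where ab: "\<And>z. z \<in> uhp \<Longrightarrow> \<alpha> z = of_real a * z + of_real b"
    "(\<lambda>n. Y (Suc n) / Y n) \<longlonglongrightarrow> a" "(\<lambda>n. (X (Suc n) - X n) / Y n) \<longlonglongrightarrow> b"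
    by (rule \<alpha>_affine) blast
  have "renorm \<phi> z0 n ((\<phi> ^^ n) (\<phi> z)) = of_real (Y (Suc n) / Y n) *
      renorm \<phi> z0 (Suc n) ((\<phi> ^^ Suc n) z) + of_real ((X (Suc n) - X n) / Y n)" for n
    using Y_pos[of n] Y_pos[of "Suc n"] by (simp add: renorm_def funpow_swap1 field_simps)
  moreover have "(\<lambda>n. of_real (Y (Suc n) / Y n) *
      renorm \<phi> z0 (Suc n) ((\<phi> ^^ Suc n) z) + of_real ((X (Suc n) - X n) / Y n))
      \<longlonglongrightarrow> of_real a * g z + of_real b"
    by (intro tendsto_intros ab LIMSEQ_Suc[OF limit_g[OF z]])
  moreover have "(\<lambda>n. renorm \<phi> z0 n ((\<phi> ^^ n) (\<phi> z))) \<longlonglongrightarrow> g (\<phi> z)"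
    using limit_g analytic_into_uhp_in[OF \<phi> z] .
  ultimately show ?thesis
    using ab(1) analytic_into_uhp_in[OF analytic_g z] by (auto intro: LIMSEQ_unique)
qed

section \<open>Pullbacks of a semiconjugation and their limit functions\<close>

text \<open>The map \<tau>^-n o \<sigma> o \<gamma>_n^-1, an approximation of the factor
  \<open>F\<close>.\<close>

definition pullback :: "(complex \<Rightarrow> complex) \<Rightarrow> (complex \<Rightarrow> complex) \<Rightarrow> nat \<Rightarrow> complex \<Rightarrow> complex" where
  "pullback \<sigma> \<tau> n w = (inv_into uhp \<tau> ^^ n) (\<sigma> (unrenorm n w))"

lemma analytic_pullback:
  assumes "analytic_into_uhp \<sigma>" "automorphism_uhp \<tau>"
  shows "analytic_into_uhp (pullback \<sigma> \<tau> n)"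
  unfolding pullback_def
  by (rule analytic_into_uhp_compose[OF analytic_into_uhp_funpow[OF automorphism_uhp_inv]
        analytic_into_uhp_compose[OF assms(1) analytic_unrenorm]]) (rule assms(2))

lemma semiconj_iter:
  assumes "\<And>z. z \<in> uhp \<Longrightarrow> \<sigma> (\<phi> z) = \<tau> (\<sigma> z)" "z \<in> uhp"
  shows "\<sigma> ((\<phi> ^^ n) z) = (\<tau> ^^ n) (\<sigma> z)"
  using assms iter_in_uhp by (induction n) simp_all

lemma pullback_renorm:
  assumes "analytic_into_uhp \<sigma>" "automorphism_uhp \<tau>"
    and "\<And>z. z \<in> uhp \<Longrightarrow> \<sigma> (\<phi> z) = \<tau> (\<sigma> z)" and z: "z \<in> uhp"
  shows "pullback \<sigma> \<tau> n (renorm \<phi> z0 n ((\<phi> ^^ n) z)) = \<sigma> z"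
  using semiconj_iter[of \<sigma> \<tau>, OF assms(3) z]
    funpow_inv_into(1)[OF assms(2) analytic_into_uhp_in[OF assms(1) z]]
  by (simp add: pullback_def unrenorm_renorm)

text \<open>The pullbacks take the fixed value \<open>\<sigma> z0\<close> at points tending to
  \<open>g z0\<close>, so \<open>Montel_uhp\<close> supplies a limit function. Evaluating them along
  \<gamma>_n(\<phi>_n(z)), where they equal \<open>\<sigma> z\<close>, identifies
  \<open>F (g z)\<close>. The subsequence is part of the conclusion because the study of
  \<open>g\<close> itself needs the convergence and not only \<open>F\<close>.\<close>

lemma factorization:
  assumes "analytic_into_uhp \<sigma>" "automorphism_uhp \<tau>"
    and "\<And>z. z \<in> uhp \<Longrightarrow> \<sigma> (\<phi> z) = \<tau> (\<sigma> z)"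
  obtains F r where "analytic_into_uhp F" "strict_mono (r :: nat \<Rightarrow> nat)"
    "\<And>K. compact K \<Longrightarrow> K \<subseteq> uhp \<Longrightarrow> uniform_limit K (\<lambda>n. pullback \<sigma> \<tau> (r n)) F sequentially"
    "\<And>z. z \<in> uhp \<Longrightarrow> F (g z) = \<sigma> z"
proof -
  note pull = pullback_renorm[OF assms(1,2) assms(3)]
  have lim: "(\<lambda>n. pullback \<sigma> \<tau> n (renorm \<phi> z0 n ((\<phi> ^^ n) z0))) \<longlonglongrightarrow> \<sigma> z0"
    using pull z0 by simp
  obtain F r where F: "analytic_into_uhp F" "strict_mono (r :: nat \<Rightarrow> nat)"
    and ul: "\<And>K. compact K \<Longrightarrow> K \<subseteq> uhp \<Longrightarrow> uniform_limit K (\<lambda>n. pullback \<sigma> \<tau> (r n)) F sequentially"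
    by (rule Montel_uhp[OF analytic_pullback[OF assms(1,2)] limit_g[OF z0]
        analytic_into_uhp_in[OF analytic_g z0] lim analytic_into_uhp_in[OF assms(1) z0]]) blast
  have "F (g z) = \<sigma> z" if z: "z \<in> uhp" for z
  proof -
    have gz: "g z \<in> uhp" using analytic_into_uhp_in[OF analytic_g z] .
    then obtain d where d: "d > 0" "cball (g z) d \<subseteq> uhp"
      using open_uhp open_contains_cball by blast
    define u where "u = (\<lambda>n. renorm \<phi> z0 (r n) ((\<phi> ^^ r n) z))"
    have u: "u \<longlonglongrightarrow> g z"
      using LIMSEQ_subseq_LIMSEQ[OF limit_g[OF z] F(2)] by (simp add: o_def u_def)
    have "(\<lambda>n. pullback \<sigma> \<tau> (r n) (u n)) \<longlonglongrightarrow> F (g z)"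
    proof (rule tendsto_uniform_limit_diagonal[OF ul u])
      show "\<forall>\<^sub>F n in sequentially. u n \<in> cball (g z) d"
        using tendstoD[OF u d(1)] by eventually_elim (simp add: dist_commute)
      show "isCont F (g z)"
        using F(1) open_uhp gz unfolding analytic_into_uhp_def
        by (meson continuous_on_eq_continuous_at holomorphic_on_imp_continuous_on)
    qed (use d in auto)
    then show ?thesis using pull z by (simp add: u_def LIMSEQ_const_iff)
  qed
  with F ul that show ?thesis by blast
qed

text \<open>The range of a nonconstant \<open>g\<close> is open, so the identity theorem extends to
  the half-plane any relation known along \<open>g\<close>.\<close>

lemma eq_on_range_g:
  assumes nc: "\<not> g constant_on uhp" and "f holomorphic_on uhp" "h holomorphic_on uhp"
    and eq: "\<And>z. z \<in> uhp \<Longrightarrow> f (g z) = h (g z)" and w: "w \<in> uhp"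
  shows "f w = h w"
proof -
  have "open (g ` uhp)"
    using open_mapping_thm[of g uhp uhp] analytic_g open_uhp connected_uhp nc
    by (simp add: analytic_into_uhp_def)
  then show ?thesis
    using analytic_g assms(2,3) eq z0 w open_uhp connected_uhp
    by (intro analytic_continuation_open[of "g ` uhp" uhp f h w])
      (auto simp: analytic_into_uhp_def)
qed

section \<open>The map induced by \<open>g\<close> on grand orbits\<close>

lemma canonical_g:
  assumes nc: "\<not> g constant_on uhp"
  shows "canonical g \<phi> \<alpha>"
proof -
  obtain F r where F: "analytic_into_uhp F" "strict_mono (r :: nat \<Rightarrow> nat)"
    and ulF: "\<And>K. compact K \<Longrightarrow> K \<subseteq> uhp \<Longrightarrow> uniform_limit K (\<lambda>n. pullback g \<alpha> (r n)) F sequentially"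
    and Fg: "\<And>z. z \<in> uhp \<Longrightarrow> F (g z) = g z"
    by (rule factorization[OF analytic_g automorphism_\<alpha> g_semiconj], assumption, rule that) blast+
  \<comment> \<open>Here the factorization is applied to the pair (g, \<alpha>) itself: its factor
    \<open>F\<close> fixes every point of the range of \<open>g\<close>.\<close>
  have Fid: "F w = w" if "w \<in> uhp" for w
    using eq_on_range_g[OF nc _ holomorphic_on_ident Fg that] F(1) by (simp add: analytic_into_uhp_def)
  have ul: "uniform_limit K (\<lambda>n. pullback g \<alpha> (r n)) (\<lambda>z. z) sequentially"
    if "compact K" "K \<subseteq> uhp" for K
    by (rule uniform_limit_cong'[THEN iffD1, OF refl _ ulF[OF that]]) (use Fid that in blast)
  have hol: "pullback g \<alpha> n holomorphic_on uhp" for n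
    using analytic_pullback[OF analytic_g automorphism_\<alpha>] by (simp add: analytic_into_uhp_def)
  have orbit_inj: "\<exists>n. (\<phi> ^^ n) z = (\<phi> ^^ n) w"
    if zw: "z \<in> uhp" "w \<in> uhp" and eq: "g z = g w" for z w
  proof -
    define u where "u = (\<lambda>z n. renorm \<phi> z0 (r n) ((\<phi> ^^ r n) z))"
    have gz: "g z \<in> uhp" using analytic_into_uhp_in[OF analytic_g zw(1)] .
    then obtain d where d: "d > 0" "cball (g z) d \<subseteq> uhp"
      using open_uhp open_contains_cball by blast
    have u: "u x \<longlonglongrightarrow> g x" if "x \<in> uhp" for x
      using LIMSEQ_subseq_LIMSEQ[OF limit_g[OF that] F(2)] by (simp add: o_def u_def)
    have d2: "d / 2 > 0" using d by simp
    have "\<forall>\<^sub>F n in sequentially. inj_on (pullback g \<alpha> (r n)) (ball (g z) (d / 2))"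
      using d hol ul open_uhp by (intro eventually_inj_of_uniform_limit_ident[where S = uhp]) auto
    \<comment> \<open>Both renormalized orbits tend to the same point \<open>g z = g w\<close>,
      hence enter the disc on which the pullback is injective; the pullback sends them to
      \<open>g z\<close> and \<open>g w\<close>, so they coincide.\<close>
    with tendstoD[OF u[OF zw(1)] d2] tendstoD[OF u[OF zw(2)] d2]
    have "\<forall>\<^sub>F n in sequentially. u z n = u w n"
    proof eventually_elim
      case (elim n)
      have "pullback g \<alpha> (r n) (u z n) = pullback g \<alpha> (r n) (u w n)"
        using pullback_renorm[OF analytic_g automorphism_\<alpha> g_semiconj] zw eq by (simp add: u_def)
      with elim eq show ?case by (auto simp: dist_commute dest: inj_onD)
    qed
    then obtain n where "u z n = u w n" by (auto simp: eventually_sequentially)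
    then show ?thesis
      unfolding u_def by (metis unrenorm_renorm)
  qed
  have orbit_surj: "\<exists>n. \<exists>z\<in>uhp. (\<alpha> ^^ n) w = g z" if w: "w \<in> uhp" for w
  proof (rule ccontr)
    assume no: "\<not> ?thesis"
    \<comment> \<open>Hurwitz's theorem produces this absurdity. A zero of
      \<open>pullback g \<alpha> (r n) - w\<close> would place \<open>(\<alpha> ^^ r n) w\<close> in
      the range of \<open>g\<close>, so these functions are zero-free; their nonconstant limit
      \<open>z - w\<close> would then be zero-free as well, even at \<open>w\<close>.\<close>
    have "w - w \<noteq> 0"
    proof (rule Hurwitz_no_zeros[OF open_uhp connected_uhp,
          of "\<lambda>n z. pullback g \<alpha> (r n) z - w" "\<lambda>z. z - w" w])
      show "(\<lambda>z. pullback g \<alpha> (r n) z - w) holomorphic_on uhp" for n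
        by (intro holomorphic_intros hol)
      show "(\<lambda>z. z - w) holomorphic_on uhp" by (intro holomorphic_intros)
      show "uniform_limit K (\<lambda>n z. pullback g \<alpha> (r n) z - w) (\<lambda>z. z - w) sequentially"
        if "compact K" "K \<subseteq> uhp" for K
        by (intro uniform_limit_intros ul that)
      show "\<not> (\<lambda>z. z - w) constant_on uhp"
      proof
        assume "(\<lambda>z. z - w) constant_on uhp"
        then obtain c where "\<And>z. z \<in> uhp \<Longrightarrow> z - w = c" by (auto simp: constant_on_def)
        from this[of \<i>] this[of "2 * \<i>"] show False by (simp add: uhp_def algebra_simps)
      qed
      show "pullback g \<alpha> (r n) z - w \<noteq> 0" if z: "z \<in> uhp" for n z
      proof
        have un: "unrenorm (r n) z \<in> uhp" using analytic_into_uhp_in[OF analytic_unrenorm z] .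
        assume "pullback g \<alpha> (r n) z - w = 0"
        then have "(\<alpha> ^^ r n) w = g (unrenorm (r n) z)"
          using funpow_inv_into(2)[OF automorphism_\<alpha> analytic_into_uhp_in[OF analytic_g un]]
          by (metis pullback_def right_minus_eq)
        with un no show False by blast
      qed
    qed (rule w)
    then show False by simp
  qed
  show ?thesis
  proof (rule canonicalI)
    show "\<phi> ` uhp \<subseteq> uhp" "g ` uhp \<subseteq> uhp"
      using \<phi> analytic_g by (auto simp: analytic_into_uhp_def)
  next
    fix z w assume "(g z, g w) \<in> grand_orbit_rel \<alpha>" and zw: "z \<in> uhp" "w \<in> uhp"
    then obtain n k where "(\<alpha> ^^ n) (g z) = (\<alpha> ^^ k) (g w)" by (auto simp: grand_orbit_rel_def)
    then have "g ((\<phi> ^^ n) z) = g ((\<phi> ^^ k) w)"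
      using semiconj_iter[of g \<alpha>, OF g_semiconj] zw by simp
    \<comment> \<open>Equality of the \<open>g\<close>-values at two orbit points becomes equality
      of the points after \<open>m\<close> further iterations.\<close>
    then obtain m where "(\<phi> ^^ m) ((\<phi> ^^ n) z) = (\<phi> ^^ m) ((\<phi> ^^ k) w)"
      using orbit_inj iter_in_uhp zw by blast
    then have "(\<phi> ^^ (m + n)) z = (\<phi> ^^ (m + k)) w" by (simp add: funpow_add)
    with zw show "(z, w) \<in> grand_orbit_rel \<phi>" by (auto simp: grand_orbit_rel_def)
  next
    fix w assume w: "w \<in> uhp"
    then obtain n z where z: "z \<in> uhp" "(\<alpha> ^^ n) w = g z" using orbit_surj by blast
    then have "(\<alpha> ^^ 0) (g z) = (\<alpha> ^^ n) w" by simp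
    with z(1) w show "\<exists>z\<in>uhp. (g z, w) \<in> grand_orbit_rel \<alpha>"
      unfolding grand_orbit_rel_def using analytic_into_uhp_in[OF analytic_g] by blast
  qed (rule g_semiconj)
qed

end

section \<open>Factoring a given semiconjugation through \<open>g\<close>\<close>

theorem proposition3p1:
  fixes A :: real and \<phi> p g \<alpha> \<sigma> \<tau> :: "complex \<Rightarrow> complex" and z0 :: complex
  assumes "self_map_uhp \<phi>"
    and "A \<ge> 1"
    and "\<And>z. z \<in> uhp \<Longrightarrow> \<phi> z = of_real A * z + p z"
    and "\<And>z. z \<in> uhp \<Longrightarrow> Im (p z) > 0"
    and "nt_lim_infinity (\<lambda>z. p z / z) 0"
    and "nonzero_step_type A \<phi>"
    and "z0 \<in> uhp"
    and "classical_semiconjugation \<phi> z0 g \<alpha>"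
    and "(\<sigma>, \<tau>) \<in> semiconjugations \<phi>"
  shows "\<exists>F. analytic_into_uhp F \<and>
             (\<forall>z\<in>uhp. \<sigma> z = F (g z)) \<and>
             (\<forall>z\<in>uhp. F (\<alpha> z) = \<tau> (F z)) \<and>
             (canonical \<sigma> \<phi> \<tau> \<longleftrightarrow> canonical F \<alpha> \<tau>)"
proof -
  have \<phi>: "analytic_into_uhp \<phi>" using assms(1) by (simp add: self_map_uhp_def)
  interpret renormalization \<phi> z0 g \<alpha>
  proof
    show "Im z \<le> Im (\<phi> z)" if "z \<in> uhp" for z
    proof -
      have "1 * Im z \<le> A * Im z"
        using assms(2) that by (intro mult_right_mono) (auto simp: uhp_def)
      then show ?thesis using assms(3,4)[OF that] by simp
    qed
  qed (use \<phi> assms in auto)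
  have \<sigma>: "analytic_into_uhp \<sigma>" and nc: "\<not> \<sigma> constant_on uhp" and \<tau>: "automorphism_uhp \<tau>"
    and semi: "\<And>z. z \<in> uhp \<Longrightarrow> \<sigma> (\<phi> z) = \<tau> (\<sigma> z)"
    using assms(9) by (auto simp: semiconjugations_def)
  obtain F where F: "analytic_into_uhp F" and Fg: "\<And>z. z \<in> uhp \<Longrightarrow> F (g z) = \<sigma> z"
    by (rule factorization[OF \<sigma> \<tau> semi], assumption, rule that) blast+
  \<comment> \<open>A constant \<open>g\<close> would make \<sigma> = F o g constant.\<close>
  have ncg: "\<not> g constant_on uhp"
    using nc Fg unfolding constant_on_def by metis
  have \<alpha>: "analytic_into_uhp \<alpha>" using automorphism_uhp_analytic[OF automorphism_\<alpha>] .
  \<comment> \<open>On the range of \<open>g\<close> this is the chain F o \<alpha> o g = F o g o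
    \<phi> = \<sigma> o \<phi> = \<tau> o \<sigma> = \<tau> o F o g; the identity theorem does the
    rest.\<close>
  have F\<alpha>: "F (\<alpha> w) = \<tau> (F w)" if "w \<in> uhp" for w
  proof (rule eq_on_range_g[OF ncg _ _ _ that])
    show "(\<lambda>w. F (\<alpha> w)) holomorphic_on uhp" "(\<lambda>w. \<tau> (F w)) holomorphic_on uhp"
      using analytic_into_uhp_compose F \<alpha> automorphism_uhp_analytic[OF \<tau>]
      by (auto simp: analytic_into_uhp_def)
    show "F (\<alpha> (g z)) = \<tau> (F (g z))" if "z \<in> uhp" for z
      using Fg g_semiconj semi that analytic_into_uhp_in[OF \<phi> that] by metis
  qed
  have "canonical \<sigma> \<phi> \<tau> \<longleftrightarrow> canonical F \<alpha> \<tau>"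
  proof (rule canonical_compose_iff)
    show "\<phi> ` uhp \<subseteq> uhp" "\<alpha> ` uhp \<subseteq> uhp" "g ` uhp \<subseteq> uhp" "F ` uhp \<subseteq> uhp"
      using \<phi> \<alpha> analytic_g F by (simp_all add: analytic_into_uhp_def)
  qed (use F\<alpha> canonical_g[OF ncg] Fg in auto)
  then show ?thesis using F Fg F\<alpha> by auto
qed

end
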